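(* Let $n\ge1$. The map $\mathbf{Q}:\mathscr{K}(S^2)\to\mathrm{Herm}(\mathbb{C}^{n+1})$ satisfies $$\mathbf{Q}(\{f,g\})=-\frac i2\big[\mathbf{Q}(f),\mathbf{Q}(g)\big]$$ for all $f,g\in\mathscr{K}(S^2)$.
   Context: $S^2=\{(x,y,z)\in\mathbb{R}^3\mid x^2+y^2+z^2=1\}$ carries the Kähler structure $(n\,g_{S^2},J_{S^2},n\,\omega_{S^2})$, where $g_{S^2}$ is the round metric, $J_{S^2}v=v\times p$ for $v\in T_pS^2$, $\omega_{S^2}=g_{S^2}(J_{S^2}\cdot,\cdot)$. A smooth function $f$ is Kähler if $\mathscr{L}_{X_f}g=0$ where, with $\omega=n\,\omega_{S^2}$, $\omega(X_f,\cdot)=df$; $\mathscr{K}(S^2)=\mathrm{Vect}_{\mathbb{R}}\{1,x,y,z\}$ with bracket $\{f,g\}=\omega(X_f,X_g)$, so that $\{x,y\}=-\frac1nz$, $\{y,z\}=-\frac1nx$, $\{z,x\}=-\frac1ny$ and $\{1,\cdot\}=0$. For $f=u_0+ux+vy+wz$, $\mathbf{Q}(f)$ is the Hermitian $(n+1)\times(n+1)$ matrix (indices $0,\dots,n$) with $\mathbf{Q}(f)_{kk}=u_0-u\frac2n(\frac n2-k)$ for $0\le k\le n$, $\mathbf{Q}(f)_{l,l+1}=\frac1n\sqrt{(n-l)(1+l)}\,(v-iw)$ for $0\le l\le n-1$, and $\mathbf{Q}(f)_{ab}=0$ for $b\ge a+2$. $[\cdot,\cdot]$ is the matrix commutator.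 *)

theory Defs
  imports
    "HOL-Analysis.Analysis"
    "Jordan_Normal_Form.Schur_Decomposition"
begin

no_notation Matrix.vec_index (infixl "$" 100)

section \<open>Smooth maps on the unit sphere\<close>

text \<open>On an open subset of a finite-dimensional space: all iterated directional
  derivatives exist and are continuous.\<close>

primrec Ck_on :: "nat \<Rightarrow> ('a::real_normed_vector \<Rightarrow> 'b::real_normed_vector) \<Rightarrow> 'a set \<Rightarrow> bool" where
  "Ck_on 0 F U \<longleftrightarrow> continuous_on U F"
| "Ck_on (Suc k) F U \<longleftrightarrow>
     (\<forall>x\<in>U. F differentiable (at x)) \<and>
     (\<forall>v. Ck_on k (\<lambda>x. frechet_derivative F (at x) v) U)"

definition smooth_on :: "('a::euclidean_space \<Rightarrow> 'b::real_normed_vector) \<Rightarrow> 'a set \<Rightarrow> bool" where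
  "smooth_on F U \<longleftrightarrow> (\<forall>k. Ck_on k F U)"

abbreviation S2 :: "(real^3) set" where
  "S2 \<equiv> sphere 0 1"

text \<open>Functions and vector fields on the sphere are maps on the ambient space of which only
  the values on the sphere matter. Since \<open>q \<mapsto> q / |q|\<close> is a smooth submersion of
  \<open>\<real>\<^sup>3 - {0}\<close> onto the sphere that restricts to the identity there, a map is smooth on the sphere
  iff its radially constant extension is smooth, and the differential of this extension
  restricts on each tangent plane to the differential of the map.\<close>

definition radial_ext :: "(real^3 \<Rightarrow> 'b::real_normed_vector) \<Rightarrow> real^3 \<Rightarrow> 'b" where
  "radial_ext F q = F (q /\<^sub>R norm q)"

definition smooth_S2 :: "(real^3 \<Rightarrow> 'b::real_normed_vector) \<Rightarrow> bool" where
  "smooth_S2 F \<longleftrightarrow> smooth_on (radial_ext F) (- {0})"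

definition diff_S2 :: "(real^3 \<Rightarrow> 'b::real_normed_vector) \<Rightarrow> real^3 \<Rightarrow> real^3 \<Rightarrow> 'b" where
  "diff_S2 F p v = frechet_derivative (radial_ext F) (at p) v"

definition tangent_S2 :: "real^3 \<Rightarrow> (real^3) set" where
  "tangent_S2 p = {v. v \<bullet> p = 0}"

definition smooth_vector_field_S2 :: "(real^3 \<Rightarrow> real^3) \<Rightarrow> bool" where
  "smooth_vector_field_S2 X \<longleftrightarrow> smooth_S2 X \<and> (\<forall>p\<in>S2. X p \<in> tangent_S2 p)"

text \<open>The sign is such that \<open>[X,Y] f = X (Y f) - Y (X f)\<close>; the normal components of the
  two ambient derivatives cancel, so the result is tangent.\<close>

definition lie_bracket_S2 :: "(real^3 \<Rightarrow> real^3) \<Rightarrow> (real^3 \<Rightarrow> real^3) \<Rightarrow> real^3 \<Rightarrow> real^3" where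
  "lie_bracket_S2 X Y p = diff_S2 Y p (X p) - diff_S2 X p (Y p)"


section \<open>The rescaled Kaehler structure\<close>

definition metric_S2 :: "nat \<Rightarrow> real^3 \<Rightarrow> real^3 \<Rightarrow> real" where
  "metric_S2 n v w = real n * (v \<bullet> w)"

definition J_S2 :: "real^3 \<Rightarrow> real^3 \<Rightarrow> real^3" where
  "J_S2 p v = cross3 v p"

definition omega_S2 :: "nat \<Rightarrow> real^3 \<Rightarrow> real^3 \<Rightarrow> real^3 \<Rightarrow> real" where
  "omega_S2 n p v w = metric_S2 n (J_S2 p v) w"

definition ham_S2 :: "nat \<Rightarrow> (real^3 \<Rightarrow> real) \<Rightarrow> real^3 \<Rightarrow> real^3" where
  "ham_S2 n f p = (THE X. X \<in> tangent_S2 p \<and>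
     (\<forall>v\<in>tangent_S2 p. omega_S2 n p X v = diff_S2 f p v))"

definition poisson_S2 :: "nat \<Rightarrow> (real^3 \<Rightarrow> real) \<Rightarrow> (real^3 \<Rightarrow> real) \<Rightarrow> real^3 \<Rightarrow> real" where
  "poisson_S2 n f g p = omega_S2 n p (ham_S2 n f p) (ham_S2 n g p)"

text \<open>\<open>(L\<^sub>X g)(Y, Z) = X (g(Y, Z)) - g([X, Y], Z) - g(Y, [X, Z])\<close>\<close>

definition lie_deriv_metric_S2 ::
  "nat \<Rightarrow> (real^3 \<Rightarrow> real^3) \<Rightarrow> (real^3 \<Rightarrow> real^3) \<Rightarrow> (real^3 \<Rightarrow> real^3) \<Rightarrow> real^3 \<Rightarrow> real" where
  "lie_deriv_metric_S2 n X Y Z p =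
     diff_S2 (\<lambda>q. metric_S2 n (Y q) (Z q)) p (X p)
     - metric_S2 n (lie_bracket_S2 X Y p) (Z p)
     - metric_S2 n (Y p) (lie_bracket_S2 X Z p)"

definition kahler_functions_S2 :: "nat \<Rightarrow> (real^3 \<Rightarrow> real) set" where
  "kahler_functions_S2 n = {f. smooth_S2 f \<and>
     (\<forall>Y Z. smooth_vector_field_S2 Y \<longrightarrow> smooth_vector_field_S2 Z \<longrightarrow>
        (\<forall>p\<in>S2. lie_deriv_metric_S2 n (ham_S2 n f) Y Z p = 0))}"


section \<open>The quantization map\<close>

definition Herm :: "nat \<Rightarrow> complex mat set" where
  "Herm m = {A \<in> carrier_mat m m. mat_adjoint A = A}"

definition superdiag :: "nat \<Rightarrow> real \<Rightarrow> real \<Rightarrow> nat \<Rightarrow> complex" where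
  "superdiag n v w l =
     complex_of_real (1 / real n * sqrt ((real n - real l) * (1 + real l)))
       * (complex_of_real v - \<i> * complex_of_real w)"

definition quant_mat :: "nat \<Rightarrow> real \<Rightarrow> real \<Rightarrow> real \<Rightarrow> real \<Rightarrow> complex mat" where
  "quant_mat n u0 u v w = Matrix.mat (n + 1) (n + 1) (\<lambda>(a, b).
     if b = a then complex_of_real (u0 - u * (2 / real n) * (real n / 2 - real a))
     else if b = a + 1 then superdiag n v w a
     else if a = b + 1 then cnj (superdiag n v w b)
     else 0)"

text \<open>The coefficients are determined by the values of the function on the sphere, because
  \<open>1, x, y, z\<close> are linearly independent there.\<close>

definition quantQ :: "nat \<Rightarrow> (real^3 \<Rightarrow> real) \<Rightarrow> complex mat" where
  "quantQ n f = (THE A. \<exists>u0 u v w.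
     (\<forall>p\<in>S2. f p = u0 + u * p$1 + v * p$2 + w * p$3) \<and> A = quant_mat n u0 u v w)"

definition commutator :: "complex mat \<Rightarrow> complex mat \<Rightarrow> complex mat" where
  "commutator A B = A * B - B * A"

end

theory Submission
  imports Defs
begin

text \<open>
  Two facts carry the proof. The analytic one is that a Kaehler function is, on the sphere, the
  restriction of an affine function \<open>c + a \<bullet> p\<close>. Without it the definite description in
  \<^const>\<open>quantQ\<close> need not denote anything, so both claims rest on it. The algebraic one is the
  commutation relation of tridiagonal matrices.

  Write \<open>X\<close> for the Hamiltonian field of \<open>f\<close>. Evaluating the Lie derivative of the metric on a
  rotation field \<open>Y\<close> (twice the same one) with \<open>Y p = e\<close>, the derivatives of \<open>Y\<close> cancel and
  \<open>DX(e) \<bullet> e = 0\<close> remains. So \<open>X\<close> has constant inner product with the velocity along each great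
  circle (Clairaut's relation), because the acceleration of the circle is normal to the sphere.
  Comparing the two end points of an arc from \<open>p\<close> to \<open>q\<close> gives \<open>X p \<bullet> q + X q \<bullet> p = 0\<close>.
  This bilinear identity forces \<open>X\<close> to be a skew-symmetric linear map, that is
  \<open>X p = b \<times> p\<close> (lemma \<open>killing_field_eq_rotation\<close>); only one derivative of
  \<open>X\<close> is ever taken. Then \<open>df(v) = \<omega>(X, v) = - n (b \<bullet> v)\<close> on tangent vectors, so
  \<open>f + n (b \<bullet> p)\<close> is constant along great circles, hence on the sphere
  (lemma \<open>kahler_function_affine\<close>).

  For affine functions with linear parts \<open>a\<close> and \<open>b\<close> the Hamiltonian fields are
  \<open>(1/n) p \<times> a\<close> and \<open>(1/n) p \<times> b\<close>, and the Poisson bracket is the linear function with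
  coefficient vector \<open>(1/n) b \<times> a\<close>. What remains, lemma \<open>quant_mat_commutator\<close>, says that the
  tridiagonal matrices form, up to scaling, the spin \<open>n/2\<close> representation of the rotation algebra. The only
  products of square roots that survive there are the squares \<open>(n - l)(1 + l) / n\<^sup>2\<close>, whose
  successive differences are the diagonal entries of the commutator.
\<close>

no_notation Matrix.scalar_prod (infix "\<bullet>" 70)

section \<open>Calculus of k-times differentiable maps\<close>

lemma Ck_on_cong:
  assumes "open U" "\<And>x. x \<in> U \<Longrightarrow> F x = G x" "Ck_on k F U"
  shows "Ck_on k G U"
  using assms(2,3)
proof (induction k arbitrary: F G)
  case 0
  then show ?case by (simp cong: continuous_on_cong)
next
  case (Suc k)
  have der: "(G has_derivative frechet_derivative F (at x)) (at x)" if "x \<in> U" for x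
    using Suc.prems that assms(1)
    by (metis Ck_on.simps(2) frechet_derivative_works has_derivative_transform_within_open)
  then have "frechet_derivative F (at x) = frechet_derivative G (at x)" if "x \<in> U" for x
    using that frechet_derivative_at by blast
  then have "Ck_on k (\<lambda>x. frechet_derivative G (at x) v) U" for v
    using Suc.IH[of "\<lambda>x. frechet_derivative F (at x) v" "\<lambda>x. frechet_derivative G (at x) v"]
      Suc.prems by simp
  then show ?case
    using der by (auto simp: differentiable_def)
qed

lemma Ck_on_SucI:
  assumes "open U" "\<And>x. x \<in> U \<Longrightarrow> (F has_derivative D x) (at x)"
    and "\<And>v. Ck_on k (\<lambda>x. D x v) U"
  shows "Ck_on (Suc k) F U"
proof -
  have "D x = frechet_derivative F (at x)" if "x \<in> U" for x
    using assms(2)[OF that] frechet_derivative_at by blast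
  then have "Ck_on k (\<lambda>x. frechet_derivative F (at x) v) U" for v
    using Ck_on_cong[OF assms(1) _ assms(3)[of v]] by simp
  then show ?thesis
    using assms(2) by (auto simp: differentiable_def)
qed

lemma Ck_on_SucD: "Ck_on (Suc k) F U \<Longrightarrow> Ck_on k F U"
proof (induction k arbitrary: F)
  case 0
  then show ?case
    by (auto intro!: continuous_at_imp_continuous_on differentiable_imp_continuous_within)
next
  case (Suc k)
  then show ?case by (metis Ck_on.simps(2))
qed

lemma Ck_on_const: "Ck_on k (\<lambda>x. c) U"
  by (induction k arbitrary: c) auto

lemma Ck_on_add:
  assumes "open U" "Ck_on k F U" "Ck_on k G U"
  shows "Ck_on k (\<lambda>x. F x + G x) U"
  using assms(2,3)
proof (induction k arbitrary: F G)
  case 0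
  then show ?case by (simp add: continuous_on_add)
next
  case (Suc k)
  show ?case
  proof (rule Ck_on_SucI[OF assms(1)])
    show "((\<lambda>x. F x + G x) has_derivative
        (\<lambda>v. frechet_derivative F (at x) v + frechet_derivative G (at x) v)) (at x)"
      if "x \<in> U" for x
      using Suc.prems that by (intro has_derivative_add) (auto simp: frechet_derivative_works[symmetric])
  qed (use Suc in auto)
qed

text \<open>The product rule needs the factors themselves as well as their derivatives at order \<open>k\<close>, and these
  are available because order \<open>k + 1\<close> implies order \<open>k\<close>.\<close>

lemma (in bounded_bilinear) Ck_on_prod:
  assumes "open U" "Ck_on k F U" "Ck_on k G U"
  shows "Ck_on k (\<lambda>x. prod (F x) (G x)) U"
  using assms(2,3)
proof (induction k arbitrary: F G)
  case 0
  then show ?case by (simp add: continuous_on)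
next
  case (Suc k)
  show ?case
  proof (rule Ck_on_SucI[OF assms(1)])
    show "((\<lambda>x. prod (F x) (G x)) has_derivative
        (\<lambda>v. prod (F x) (frechet_derivative G (at x) v) + prod (frechet_derivative F (at x) v) (G x))) (at x)"
      if "x \<in> U" for x
      using Suc.prems that by (intro FDERIV) (auto simp: frechet_derivative_works[symmetric])
    show "Ck_on k (\<lambda>x. prod (F x) (frechet_derivative G (at x) v)
        + prod (frechet_derivative F (at x) v) (G x)) U" for v
      using Suc.prems by (intro Ck_on_add[OF assms(1)] Suc.IH Ck_on_SucD[OF Suc.prems(1)] Ck_on_SucD[OF Suc.prems(2)]) auto
  qed
qed

lemma (in bounded_linear) Ck_on_linear:
  assumes "open U"
  shows "Ck_on k f U"
proof (cases k)
  case 0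
  then show ?thesis by (simp add: linear_continuous_on bounded_linear_axioms)
next
  case (Suc m)
  then show ?thesis
    using Ck_on_SucI[OF assms has_derivative[OF has_derivative_ident] Ck_on_const] by simp
qed

lemma has_derivative_inverse_norm:
  fixes x :: "'a::euclidean_space"
  assumes "x \<noteq> 0"
  shows "((\<lambda>x. inverse (norm x)) has_derivative
    (\<lambda>v. (x \<bullet> (- v)) * (inverse (norm x) * (inverse (norm x) * inverse (norm x))))) (at x)"
  by (rule has_derivative_eq_rhs[OF Deriv.has_derivative_inverse[OF _ has_derivative_norm[OF assms]]])
    (use assms in \<open>auto simp: sgn_div_norm field_simps inner_commute\<close>)

text \<open>The derivative of \<open>1 / |x|\<close> is a linear function of \<open>x\<close> times a cube of \<open>1 / |x|\<close>, so smoothness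
  propagates by induction through the product rule.\<close>

lemma Ck_on_inverse_norm: "Ck_on k (\<lambda>x::'a::euclidean_space. inverse (norm x)) (- {0})"
proof (induction k)
  case 0
  then show ?case by (auto intro!: continuous_intros)
next
  case (Suc k)
  have op: "open (- {0::'a})" by auto
  note mult = bounded_bilinear.Ck_on_prod[OF bounded_bilinear_mult op]
  show ?case
  proof (rule Ck_on_SucI[OF op has_derivative_inverse_norm])
    show "Ck_on k (\<lambda>x::'a. (x \<bullet> (- v)) * (inverse (norm x) * (inverse (norm x) * inverse (norm x))))
        (- {0})" for v
      by (intro mult Suc bounded_linear.Ck_on_linear[OF bounded_linear_inner_left] op)
  qed auto
qed

text \<open>The radially constant extension of a linear map is the map divided by the norm. Applied to cross
  products, this provides the test fields on which the Lie derivative of the metric is evaluated.\<close>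

lemma smooth_S2_linear:
  assumes "bounded_linear L"
  shows "smooth_S2 L"
proof -
  have "Ck_on k (\<lambda>q. inverse (norm q) *\<^sub>R L q) (- {0})" for k
    by (intro bounded_bilinear.Ck_on_prod[OF bounded_bilinear_scaleR] Ck_on_inverse_norm
        bounded_linear.Ck_on_linear assms) auto
  moreover have "radial_ext L = (\<lambda>q. inverse (norm q) *\<^sub>R L q)"
    by (auto simp: radial_ext_def linear_cmul[OF bounded_linear.linear[OF assms]])
  ultimately show ?thesis
    by (simp add: smooth_S2_def smooth_on_def)
qed

section \<open>Differentials on the sphere\<close>

lemma has_derivative_radial_projection:
  assumes "p \<in> S2"
  shows "((\<lambda>q::real^3. q /\<^sub>R norm q) has_derivative (\<lambda>v. v - (v \<bullet> p) *\<^sub>R p)) (at p)"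
proof -
  from assms have [simp]: "norm p = 1" "p \<noteq> 0" by auto
  show ?thesis
    by (rule has_derivative_eq_rhs[OF has_derivative_scaleR[OF has_derivative_inverse_norm has_derivative_ident]])
      (auto simp: inner_commute)
qed

lemma radial_projection_differentiable:
  fixes q :: "real^3"
  assumes "q \<noteq> 0"
  shows "(\<lambda>q. q /\<^sub>R norm q) differentiable (at q)"
  using has_derivative_scaleR[OF has_derivative_inverse_norm[OF assms] has_derivative_ident]
  by (auto simp: differentiable_def)

lemma radial_ext_eq [simp]: "p \<in> S2 \<Longrightarrow> radial_ext F p = F p"
  by (simp add: radial_ext_def)

lemma smooth_S2_has_derivative:
  assumes "smooth_S2 F" "p \<in> S2"
  shows "(radial_ext F has_derivative diff_S2 F p) (at p)"
proof -
  have "Ck_on (Suc 0) (radial_ext F) (- {0})"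
    using assms(1) unfolding smooth_S2_def smooth_on_def by blast
  then have "radial_ext F differentiable (at p)"
    using assms(2) by auto
  then show ?thesis
    unfolding diff_S2_def[abs_def] using frechet_derivative_works by blast
qed

lemma smooth_S2_diff_differentiable:
  assumes "smooth_S2 F" "p \<in> S2"
  shows "(\<lambda>q. diff_S2 F q v) differentiable (at p)"
proof -
  have "Ck_on (Suc (Suc 0)) (radial_ext F) (- {0})"
    using assms(1) unfolding smooth_S2_def smooth_on_def by blast
  then have "\<forall>x\<in>- {0}. (\<lambda>q. frechet_derivative (radial_ext F) (at q) v) differentiable (at x)"
    unfolding Ck_on.simps by blast
  moreover have "p \<in> - {0}" using assms(2) by auto
  ultimately show ?thesis
    unfolding diff_S2_def[abs_def] by blast
qed

lemma diff_S2_eqI: "(radial_ext F has_derivative D) (at p) \<Longrightarrow> diff_S2 F p = D"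
  by (drule frechet_derivative_at) (rule ext, simp only: diff_S2_def)

lemma diff_S2_affine:
  assumes f: "\<And>q. q \<in> S2 \<Longrightarrow> f q = c + a \<bullet> q" and p: "p \<in> S2" and v: "v \<in> tangent_S2 p"
  shows "diff_S2 f p v = a \<bullet> v"
proof -
  have "((\<lambda>q. c + a \<bullet> (q /\<^sub>R norm q)) has_derivative (\<lambda>v. 0 + a \<bullet> (v - (v \<bullet> p) *\<^sub>R p))) (at p)"
    by (intro has_derivative_add has_derivative_const has_derivative_inner_right
        has_derivative_radial_projection p)
  then have "(radial_ext f has_derivative (\<lambda>v. 0 + a \<bullet> (v - (v \<bullet> p) *\<^sub>R p))) (at p)"
    by (rule has_derivative_transform_within_open[where s = "- {0}"])
      (use p f in \<open>auto simp: radial_ext_def\<close>)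
  from diff_S2_eqI[OF this] v show ?thesis
    by (simp add: tangent_S2_def)
qed

section \<open>Hamiltonian vector fields\<close>

lemma cross_cross_self:
  assumes "p \<in> S2"
  shows "cross3 (cross3 p a) p = a - (a \<bullet> p) *\<^sub>R p"
proof -
  have "p \<bullet> p = 1" using assms by (simp add: dot_square_norm)
  then show ?thesis
    using Lagrange[of p p a]
    by (metis cross_skew inner_commute minus_diff_eq scaleR_one)
qed

text \<open>Testing against \<open>v = X \<times> p\<close> gives \<open>|X \<times> p| = 0\<close>, and \<open>|X \<times> p| = |X|\<close> for \<open>X\<close> orthogonal to the
  unit vector \<open>p\<close>. This is what makes Hamiltonian fields unique.\<close>

lemma omega_S2_nondegenerate:
  assumes "n \<ge> 1" "p \<in> S2" "X \<in> tangent_S2 p"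
    and "\<And>v. v \<in> tangent_S2 p \<Longrightarrow> omega_S2 n p X v = 0"
  shows "X = 0"
proof -
  have "cross3 X p \<in> tangent_S2 p"
    by (simp add: tangent_S2_def dot_cross_self)
  from assms(4)[OF this] assms(1) have "cross3 X p = 0"
    by (simp add: omega_S2_def metric_S2_def J_S2_def)
  then have "(norm X)\<^sup>2 = 0"
    using norm_cross_dot[of X p] assms(2,3) by (simp add: tangent_S2_def)
  then show ?thesis by simp
qed

lemma omega_S2_cross_left:
  assumes "n \<ge> 1" "p \<in> S2" "v \<in> tangent_S2 p"
  shows "omega_S2 n p ((1 / real n) *\<^sub>R cross3 p a) v = a \<bullet> v"
  using assms cross_cross_self[OF assms(2), of a]
  by (simp add: omega_S2_def metric_S2_def J_S2_def cross_mult_left inner_diff_left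
      tangent_S2_def inner_commute[of p v])

lemma ham_S2_eqI:
  assumes "n \<ge> 1" "p \<in> S2" "\<And>v. v \<in> tangent_S2 p \<Longrightarrow> diff_S2 f p v = a \<bullet> v"
  shows "ham_S2 n f p = (1 / real n) *\<^sub>R cross3 p a"
  unfolding ham_S2_def
proof (rule the_equality)
  let ?X = "(1 / real n) *\<^sub>R cross3 p a"
  show X: "?X \<in> tangent_S2 p \<and> (\<forall>v\<in>tangent_S2 p. omega_S2 n p ?X v = diff_S2 f p v)"
    using assms omega_S2_cross_left by (simp add: tangent_S2_def dot_cross_self)
  fix Z assume Z: "Z \<in> tangent_S2 p \<and> (\<forall>v\<in>tangent_S2 p. omega_S2 n p Z v = diff_S2 f p v)"
  have "Z - ?X = 0"
  proof (rule omega_S2_nondegenerate[OF assms(1,2)])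
    show "Z - ?X \<in> tangent_S2 p"
      using X Z by (simp add: tangent_S2_def inner_diff_left)
    have "omega_S2 n p (Z - ?X) v = omega_S2 n p Z v - omega_S2 n p ?X v" for v
      by (simp add: omega_S2_def metric_S2_def J_S2_def Cross3.left_diff_distrib inner_diff_left
          Rings.right_diff_distrib)
    then show "omega_S2 n p (Z - ?X) v = 0" if "v \<in> tangent_S2 p" for v
      using X Z that by simp
  qed
  then show "Z = ?X" by simp
qed

lemma poisson_S2_affine:
  assumes "n \<ge> 1" "p \<in> S2"
    and "\<And>q. q \<in> S2 \<Longrightarrow> f q = c + a \<bullet> q" "\<And>q. q \<in> S2 \<Longrightarrow> g q = d + b \<bullet> q"
  shows "poisson_S2 n f g p = ((1 / real n) *\<^sub>R cross3 b a) \<bullet> p"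
proof -
  have "poisson_S2 n f g p
      = omega_S2 n p ((1 / real n) *\<^sub>R cross3 p a) ((1 / real n) *\<^sub>R cross3 p b)"
    unfolding poisson_S2_def
    using ham_S2_eqI[OF assms(1,2) diff_S2_affine[OF assms(3) assms(2)]]
      ham_S2_eqI[OF assms(1,2) diff_S2_affine[OF assms(4) assms(2)]] by simp
  also have "\<dots> = a \<bullet> ((1 / real n) *\<^sub>R cross3 p b)"
    by (rule omega_S2_cross_left) (use assms in \<open>auto simp: tangent_S2_def dot_cross_self\<close>)
  also have "\<dots> = ((1 / real n) *\<^sub>R cross3 b a) \<bullet> p"
    using cross_triple[of p b a] by (simp add: inner_commute)
  finally show ?thesis .
qed

text \<open>For smooth \<open>f\<close> the radial extension is constant along rays, so this ambient gradient is tangent to the sphere.\<close>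

definition grad_S2 :: "(real^3 \<Rightarrow> real) \<Rightarrow> real^3 \<Rightarrow> real^3" where
  "grad_S2 f p = (\<Sum>b\<in>Basis. diff_S2 f p b *\<^sub>R b)"

lemma diff_S2_eq_grad:
  assumes "smooth_S2 f" "p \<in> S2"
  shows "diff_S2 f p v = grad_S2 f p \<bullet> v"
proof -
  have lin: "linear (diff_S2 f p)"
    using smooth_S2_has_derivative[OF assms] by (rule has_derivative_linear)
  have "diff_S2 f p v = diff_S2 f p (\<Sum>b\<in>Basis. (v \<bullet> b) *\<^sub>R b)"
    by (simp add: euclidean_representation)
  also have "\<dots> = grad_S2 f p \<bullet> v"
    by (simp add: linear_sum[OF lin] linear_cmul[OF lin] grad_S2_def inner_sum_left
        inner_commute[of v] mult.commute)
  finally show ?thesis .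
qed

lemma ham_S2_eq_cross_grad:
  assumes "n \<ge> 1" "smooth_S2 f" "p \<in> S2"
  shows "ham_S2 n f p = (1 / real n) *\<^sub>R cross3 p (grad_S2 f p)"
  using assms by (intro ham_S2_eqI diff_S2_eq_grad)

text \<open>The Hamiltonian field is defined pointwise by a definite description, so its differentiability is
  not automatic: it comes from the second derivatives of \<open>f\<close> through the formula \<open>(1/n) p \<times> grad f\<close>.\<close>

lemma ham_S2_has_derivative:
  assumes "n \<ge> 1" "smooth_S2 f" "p \<in> S2"
  shows "(radial_ext (ham_S2 n f) has_derivative diff_S2 (ham_S2 n f) p) (at p)"
proof -
  let ?r = "\<lambda>q::real^3. q /\<^sub>R norm q"
  have r: "?r differentiable (at p)"
    using assms(3) by (intro radial_projection_differentiable) auto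
  have "(\<lambda>q. grad_S2 f (?r q)) differentiable (at p)"
    unfolding grad_S2_def
  proof (intro differentiable_sum ballI differentiable_scaleR differentiable_const)
    fix b :: "real^3"
    show "(\<lambda>q. diff_S2 f (?r q) b) differentiable (at p)"
      using differentiable_chain_at[OF r, of "\<lambda>q. diff_S2 f q b"]
        smooth_S2_diff_differentiable[OF assms(2,3), of b] assms(3)
      by (simp add: o_def)
  qed auto
  then obtain D where
    "((\<lambda>q. (1 / real n) *\<^sub>R cross3 (?r q) (grad_S2 f (?r q))) has_derivative D) (at p)"
    using r has_derivative_scaleR_right[OF bounded_bilinear.FDERIV[OF
          bilinear_conv_bounded_bilinear[THEN iffD1, OF bilinear_cross]]]
    unfolding differentiable_def by blast
  then have "(radial_ext (ham_S2 n f) has_derivative D) (at p)"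
    by (rule has_derivative_transform_within_open[where s = "- {0}"])
      (use assms in \<open>auto simp: radial_ext_def ham_S2_eq_cross_grad\<close>)
  with diff_S2_eqI[OF this] show ?thesis by simp
qed

section \<open>Infinitesimal isometries of the sphere are rotations\<close>

lemma smooth_vector_field_S2_rotation: "smooth_vector_field_S2 (cross3 c)"
  using bilinear_conv_bounded_bilinear[THEN iffD1, OF bilinear_cross]
  by (auto simp: smooth_vector_field_S2_def tangent_S2_def dot_cross_self
      intro!: smooth_S2_linear bounded_bilinear.bounded_linear_right)

text \<open>The Lie derivative is evaluated at \<open>Y = Z\<close>, where \<open>Y\<close> is the rotation field about \<open>p \<times> e\<close>, whose
  value at \<open>p\<close> is \<open>e\<close>. The terms containing the derivative of \<open>Y\<close> cancel, because
  \<open>X(Y \<bullet> Y) = 2 (DY(X) \<bullet> Y)\<close>.\<close>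

lemma killing_equation:
  assumes "n \<ge> 1" "f \<in> kahler_functions_S2 n" "p \<in> S2" "e \<in> tangent_S2 p"
  shows "diff_S2 (ham_S2 n f) p e \<bullet> e = 0"
proof -
  let ?X = "ham_S2 n f" and ?Y = "cross3 (cross3 p e)"
  have Yp: "?Y p = e"
    using cross_cross_self[OF assms(3), of e] assms(4) by (simp add: tangent_S2_def)
  have smY: "smooth_vector_field_S2 ?Y"
    by (rule smooth_vector_field_S2_rotation)
  then have Y: "(radial_ext ?Y has_derivative diff_S2 ?Y p) (at p)"
    using assms(3) by (intro smooth_S2_has_derivative) (auto simp: smooth_vector_field_S2_def)
  have "((\<lambda>q. real n * (radial_ext ?Y q \<bullet> radial_ext ?Y q)) has_derivative
      (\<lambda>v. real n * (2 * (diff_S2 ?Y p v \<bullet> e)))) (at p)"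
    by (rule has_derivative_eq_rhs[OF has_derivative_mult_right[OF has_derivative_inner[OF Y Y]]])
      (use assms(3) Yp in \<open>auto simp: inner_commute\<close>)
  also have "(\<lambda>q. real n * (radial_ext ?Y q \<bullet> radial_ext ?Y q))
      = radial_ext (\<lambda>q. metric_S2 n (?Y q) (?Y q))"
    by (simp add: radial_ext_def[abs_def] metric_S2_def)
  finally have "diff_S2 (\<lambda>q. metric_S2 n (?Y q) (?Y q)) p
      = (\<lambda>v. real n * (2 * (diff_S2 ?Y p v \<bullet> e)))"
    by (rule diff_S2_eqI)
  moreover have "lie_deriv_metric_S2 n ?X ?Y ?Y p = 0"
    using assms(2,3) smY by (auto simp: kahler_functions_S2_def)
  ultimately have "real n * (2 * (diff_S2 ?X p e \<bullet> e)) = 0"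
    using Yp by (simp add: lie_deriv_metric_S2_def lie_bracket_S2_def metric_S2_def
        inner_diff_left inner_diff_right inner_commute algebra_simps)
  then show ?thesis using assms(1) by simp
qed

definition great_circle :: "real^3 \<Rightarrow> real^3 \<Rightarrow> real \<Rightarrow> real^3" where
  "great_circle p e t = cos t *\<^sub>R p + sin t *\<^sub>R e"

definition great_circle_velocity :: "real^3 \<Rightarrow> real^3 \<Rightarrow> real \<Rightarrow> real^3" where
  "great_circle_velocity p e t = cos t *\<^sub>R e - sin t *\<^sub>R p"

lemma great_circle_through:
  assumes "p \<in> S2" "q \<in> S2"
  obtains e t where "e \<in> S2" "e \<in> tangent_S2 p" "q = great_circle p e t"
proof -
  define w where "w = q - (q \<bullet> p) *\<^sub>R p"
  have pp: "p \<bullet> p = 1" and qq: "q \<bullet> q = 1" using assms by (auto simp: dot_square_norm)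
  have wp: "w \<bullet> p = 0" using pp by (simp add: w_def inner_diff_left)
  obtain e where e: "e \<in> S2" "e \<bullet> p = 0" "w = norm w *\<^sub>R e"
  proof (cases "w = 0")
    case True
    obtain y where "y \<noteq> 0" "Linear_Algebra.orthogonal p y"
      using orthogonal_to_vector_exists[of p] by auto
    then show ?thesis
      using that[of "y /\<^sub>R norm y"] True by (auto simp: Linear_Algebra.orthogonal_def inner_commute tangent_S2_def)
  next
    case False
    then show ?thesis using that[of "w /\<^sub>R norm w"] wp by auto
  qed
  have "(q \<bullet> p)\<^sup>2 + (norm w)\<^sup>2 = 1"
    using pp qq
    unfolding w_def power2_norm_eq_inner
    by (simp add: inner_diff_left inner_diff_right inner_commute power2_eq_square)
  then obtain t where "q \<bullet> p = cos t" "norm w = sin t"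
    using sincos_total_2pi_le by metis
  then have "q = great_circle p e t" using e(3) by (simp add: w_def great_circle_def algebra_simps)
  then show ?thesis using that e by (auto simp: tangent_S2_def)
qed

lemma great_circle_mem:
  assumes "p \<in> S2" "e \<in> S2" "e \<in> tangent_S2 p"
  shows "great_circle p e t \<in> S2"
    and "great_circle_velocity p e t \<in> tangent_S2 (great_circle p e t)"
proof -
  have [simp]: "p \<bullet> p = 1" "e \<bullet> e = 1" "e \<bullet> p = 0" "p \<bullet> e = 0"
    using assms by (auto simp: dot_square_norm tangent_S2_def inner_commute)
  show "great_circle p e t \<in> S2"
    by (simp add: great_circle_def norm_eq_1 inner_add_left inner_add_right flip: power2_eq_square)
  show "great_circle_velocity p e t \<in> tangent_S2 (great_circle p e t)"
    by (simp add: great_circle_def great_circle_velocity_def tangent_S2_def inner_add_right inner_diff_left)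
qed

lemma has_vector_derivative_great_circle:
  "(great_circle p e has_vector_derivative great_circle_velocity p e t) (at t)"
  "(great_circle_velocity p e has_vector_derivative - great_circle p e t) (at t)"
  unfolding great_circle_def[abs_def] great_circle_velocity_def[abs_def]
  by (auto intro!: derivative_eq_intros simp: algebra_simps)

lemma has_vector_derivative_along_great_circle:
  assumes "(radial_ext F has_derivative diff_S2 F (great_circle p e t)) (at (great_circle p e t))"
  shows "((\<lambda>t. radial_ext F (great_circle p e t)) has_vector_derivative
    diff_S2 F (great_circle p e t) (great_circle_velocity p e t)) (at t)"
  using vector_derivative_diff_chain_within[OF has_vector_derivative_great_circle(1), of "radial_ext F"]
    has_derivative_at_withinI[OF assms] by (simp add: o_def)

text \<open>The derivative along the circle \<open>\<gamma>\<close> of \<open>X(\<gamma>) \<bullet> \<gamma>'\<close> is \<open>DX(\<gamma>') \<bullet> \<gamma>' + X(\<gamma>) \<bullet> \<gamma>''\<close>. The first term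
  vanishes by the Killing equation, the second because \<open>\<gamma>'' = - \<gamma>\<close> is normal and \<open>X\<close> is tangent.\<close>

lemma clairaut:
  assumes der: "\<And>p. p \<in> S2 \<Longrightarrow> (radial_ext X has_derivative diff_S2 X p) (at p)"
    and tan: "\<And>p. p \<in> S2 \<Longrightarrow> X p \<in> tangent_S2 p"
    and kil: "\<And>p v. p \<in> S2 \<Longrightarrow> v \<in> tangent_S2 p \<Longrightarrow> diff_S2 X p v \<bullet> v = 0"
    and p: "p \<in> S2" and e: "e \<in> S2" "e \<in> tangent_S2 p"
  shows "X (great_circle p e t) \<bullet> great_circle_velocity p e t = X p \<bullet> e"
proof -
  note mem = great_circle_mem[OF p e]
  let ?h = "\<lambda>t. radial_ext X (great_circle p e t) \<bullet> great_circle_velocity p e t"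
  have "(?h has_real_derivative 0) (at t)" for t
  proof -
    have "X (great_circle p e t) \<bullet> great_circle p e t = 0"
      using tan[OF mem(1)] by (simp add: tangent_S2_def)
    moreover note kil[OF mem(1) mem(2)]
    moreover have "(?h has_vector_derivative (X (great_circle p e t) \<bullet> (- great_circle p e t) 
        + diff_S2 X (great_circle p e t) (great_circle_velocity p e t) \<bullet> great_circle_velocity p e t)) (at t)"
      using bounded_bilinear.has_vector_derivative[OF bounded_bilinear_inner
          has_vector_derivative_along_great_circle[OF der[OF mem(1)]] has_vector_derivative_great_circle(2)]
        mem(1) by simp
    ultimately show ?thesis
      by (simp add: has_real_derivative_iff_has_vector_derivative inner_minus_right)
  qed
  then have "?h t = ?h 0" using DERIV_isconst_all by blast
  then show ?thesis using mem(1) p by (simp add: great_circle_def great_circle_velocity_def)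
qed

text \<open>On a great circle through \<open>p\<close> and \<open>q\<close>, tangency at \<open>q\<close> and Clairaut's relation are two linear
  equations for the components of \<open>X q\<close> along \<open>p\<close> and \<open>e\<close>; eliminating the latter gives
  \<open>X q \<bullet> p = - sin t (X p \<bullet> e) = - X p \<bullet> q\<close>.\<close>

lemma killing_field_skew:
  assumes der: "\<And>p. p \<in> S2 \<Longrightarrow> (radial_ext X has_derivative diff_S2 X p) (at p)"
    and tan: "\<And>p. p \<in> S2 \<Longrightarrow> X p \<in> tangent_S2 p"
    and kil: "\<And>p v. p \<in> S2 \<Longrightarrow> v \<in> tangent_S2 p \<Longrightarrow> diff_S2 X p v \<bullet> v = 0"
    and p: "p \<in> S2" and q: "q \<in> S2"
  shows "X p \<bullet> q + X q \<bullet> p = 0"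
proof -
  obtain e t where e: "e \<in> S2" "e \<in> tangent_S2 p" and qe: "q = great_circle p e t"
    using great_circle_through[OF p q] .
  have 1: "cos t * (X q \<bullet> p) + sin t * (X q \<bullet> e) = 0"
    using tan[OF q] by (simp add: tangent_S2_def inner_add_right qe great_circle_def)
  have 2: "- sin t * (X q \<bullet> p) + cos t * (X q \<bullet> e) = X p \<bullet> e"
    using clairaut[OF der tan kil p e, of t]
    by (simp add: qe great_circle_velocity_def inner_diff_right)
  have 3: "X p \<bullet> q = sin t * (X p \<bullet> e)"
    using tan[OF p] by (simp add: tangent_S2_def inner_add_right qe great_circle_def)
  have "(sin t)\<^sup>2 + (cos t)\<^sup>2 = 1" by simp
  then have "X q \<bullet> p = (sin t)\<^sup>2 * (X q \<bullet> p) + (cos t)\<^sup>2 * (X q \<bullet> p)"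
    by (simp flip: distrib_right)
  also have "\<dots> = cos t * (cos t * (X q \<bullet> p) + sin t * (X q \<bullet> e))
      - sin t * (- sin t * (X q \<bullet> p) + cos t * (X q \<bullet> e))"
    by (simp add: algebra_simps power2_eq_square)
  also have "\<dots> = - (X p \<bullet> q)"
    unfolding 1 2 3 by simp
  finally show ?thesis by simp
qed

text \<open>Taking \<open>q\<close> to be the basis vectors expresses each component of \<open>X p\<close> linearly in \<open>p\<close>, with a
  coefficient matrix that is skew-symmetric for the same reason. A skew-symmetric matrix on
  three-space acts as a cross product.\<close>

lemma killing_field_eq_rotation:
  assumes skew: "\<And>p q. p \<in> S2 \<Longrightarrow> q \<in> S2 \<Longrightarrow> X p \<bullet> q + X q \<bullet> p = 0"
  obtains c where "\<And>p. p \<in> S2 \<Longrightarrow> X p = cross3 c p"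
proof
  define a where "a i j = X (axis i 1) $ j" for i j
  have S: "axis i 1 \<in> S2" for i :: 3 by (simp add: norm_axis_1)
  have comp: "X p $ j = - (\<Sum>k\<in>UNIV. a j k * p $ k)" if "p \<in> S2" for p j
    using skew[OF that S, of j] by (simp add: a_def inner_axis) (simp add: inner_vec_def)
  have anti: "a i j = - a j i" for i j
    using skew[OF S S, of i j] by (simp add: a_def inner_axis)
  show "X p = cross3 (vector [a 2 3, a 3 1, a 1 2]) p" if "p \<in> S2" for p
    unfolding Finite_Cartesian_Product.vec_eq_iff
    using comp[OF that, of 1] comp[OF that, of 2] comp[OF that, of 3] anti[of 1 1] anti[of 2 2] anti[of 3 3] anti[of 1 2] anti[of 1 3] anti[of 2 3]
    by (simp add: forall_3 sum_3 cross_components algebra_simps)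
qed

text \<open>Since \<open>X p = b \<times> p\<close>, the differential of \<open>f\<close> on tangent vectors is that of \<open>- n (b \<bullet> p)\<close>; every
  point is joined to a base point by a great circle, along which the difference is constant.\<close>

lemma kahler_function_affine:
  assumes "n \<ge> 1" "f \<in> kahler_functions_S2 n"
  obtains c a where "\<And>p. p \<in> S2 \<Longrightarrow> f p = c + a \<bullet> p"
proof -
  have sm: "smooth_S2 f" using assms(2) by (simp add: kahler_functions_S2_def)
  let ?X = "ham_S2 n f"
  have X: "?X p = (1 / real n) *\<^sub>R cross3 p (grad_S2 f p)" if "p \<in> S2" for p
    using ham_S2_eq_cross_grad[OF assms(1) sm that] .
  have tan: "?X p \<in> tangent_S2 p" if "p \<in> S2" for p
    using X[OF that] by (simp add: tangent_S2_def dot_cross_self)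
  obtain b where b: "\<And>p. p \<in> S2 \<Longrightarrow> ?X p = cross3 b p"
    using killing_field_eq_rotation[of ?X]
      killing_field_skew[OF ham_S2_has_derivative[OF assms(1) sm] tan killing_equation[OF assms]]
    by metis
  have df: "diff_S2 f p v = - real n * (b \<bullet> v)" if "p \<in> S2" "v \<in> tangent_S2 p" for p v
  proof -
    have "diff_S2 f p v = omega_S2 n p (?X p) v"
      using that X diff_S2_eq_grad[OF sm] omega_S2_cross_left[OF assms(1)] by simp
    also have "\<dots> = real n * (cross3 (cross3 b p) p \<bullet> v)"
      using b that by (simp add: omega_S2_def metric_S2_def J_S2_def)
    also have "cross3 (cross3 b p) p = (b \<bullet> p) *\<^sub>R p - b"
      using cross_cross_self[OF that(1), of b] by (metis cross_skew cross_minus_left minus_diff_eq)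
    finally show ?thesis
      using that by (simp add: tangent_S2_def inner_diff_left inner_commute[of p v])
  qed
  define p0 :: "real^3" where "p0 = axis 1 1"
  have p0: "p0 \<in> S2" by (simp add: p0_def norm_axis_1)
  show ?thesis
  proof (rule that)
    fix q assume q: "q \<in> S2"
    obtain e t where e: "e \<in> S2" "e \<in> tangent_S2 p0" and qe: "q = great_circle p0 e t"
      using great_circle_through[OF p0 q] .
    note mem = great_circle_mem[OF p0 e]
    let ?h = "\<lambda>t. radial_ext f (great_circle p0 e t) + real n * (b \<bullet> great_circle p0 e t)"
    have "(?h has_real_derivative 0) (at t)" for t
    proof -
      have "(?h has_vector_derivative (diff_S2 f (great_circle p0 e t) (great_circle_velocity p0 e t)
          + real n * (b \<bullet> great_circle_velocity p0 e t))) (at t)"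
        by (intro has_vector_derivative_add has_vector_derivative_along_great_circle
            smooth_S2_has_derivative sm mem has_vector_derivative_mult_right
            bounded_linear.has_vector_derivative[OF bounded_linear_inner_right]
            has_vector_derivative_great_circle)
      then show ?thesis
        using df[OF mem(1) mem(2)] by (simp add: has_real_derivative_iff_has_vector_derivative)
    qed
    then have "?h t = ?h 0" using DERIV_isconst_all by blast
    then have "f q + real n * (b \<bullet> q) = f p0 + real n * (b \<bullet> p0)"
      using mem(1) p0 qe q by (simp add: great_circle_def)
    then show "f q = (f p0 + real n * (b \<bullet> p0)) + (- real n *\<^sub>R b) \<bullet> q"
      by simp
  qed
qed

section \<open>The quantization map on affine functions\<close>

text \<open>The values at the points \<open>\<plusminus>e\<^sub>1\<close>, \<open>e\<^sub>2\<close>, \<open>e\<^sub>3\<close> already determine the four coefficients.\<close>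

lemma quantQ_affine:
  assumes f: "\<And>p. p \<in> S2 \<Longrightarrow> f p = c + a \<bullet> p"
  shows "quantQ n f = quant_mat n c (a$1) (a$2) (a$3)"
  unfolding quantQ_def
proof (rule the_equality)
  show "\<exists>u0 u v w. (\<forall>p\<in>S2. f p = u0 + u * p$1 + v * p$2 + w * p$3) \<and>
      quant_mat n c (a$1) (a$2) (a$3) = quant_mat n u0 u v w"
    using f by (intro exI[of _ c] exI[of _ "a$1"] exI[of _ "a$2"] exI[of _ "a$3"])
      (simp add: inner_vec_def sum_3)
next
  fix A
  assume "\<exists>u0 u v w. (\<forall>p\<in>S2. f p = u0 + u * p$1 + v * p$2 + w * p$3) \<and> A = quant_mat n u0 u v w"
  then obtain u0 u v w where
    h: "\<And>p. p \<in> S2 \<Longrightarrow> f p = u0 + u * p$1 + v * p$2 + w * p$3" and A: "A = quant_mat n u0 u v w"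
    by blast
  have eq: "c + a \<bullet> p = u0 + u * p$1 + v * p$2 + w * p$3" if "p \<in> S2" for p
    using f h that by metis
  have S: "axis i 1 \<in> S2" "- axis i 1 \<in> S2" for i :: 3 by (simp_all add: norm_axis_1)
  have "u0 = c \<and> u = a$1 \<and> v = a$2 \<and> w = a$3"
    using eq[OF S(1), of 1] eq[OF S(2), of 1] eq[OF S(1), of 2] eq[OF S(1), of 3]
    by (simp add: axis_def inner_vec_def sum_3)
  with A show "A = quant_mat n c (a$1) (a$2) (a$3)" by simp
qed

lemma mat_adjoint_dim [simp]:
  "dim_row (mat_adjoint A) = dim_col A" "dim_col (mat_adjoint A) = dim_row A"
  by (simp_all add: mat_adjoint_def)

lemma mat_adjoint_index:
  "i < dim_col A \<Longrightarrow> j < dim_row A \<Longrightarrow> mat_adjoint A $$ (i, j) = conjugate (A $$ (j, i))"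
  by (simp add: mat_adjoint_def mat_of_rows_def)

lemma dim_quant_mat [simp]:
  "dim_row (quant_mat n u0 u v w) = n + 1" "dim_col (quant_mat n u0 u v w) = n + 1"
  by (simp_all add: quant_mat_def)

lemma quant_mat_Herm: "quant_mat n u0 u v w \<in> Herm (n + 1)"
proof -
  have "mat_adjoint (quant_mat n u0 u v w) = quant_mat n u0 u v w"
    by (rule eq_matI) (auto simp: mat_adjoint_index, auto simp: quant_mat_def)
  moreover have "quant_mat n u0 u v w \<in> carrier_mat (n + 1) (n + 1)"
    by (rule carrier_matI) simp_all
  ultimately show ?thesis unfolding Herm_def by blast
qed

text \<open>The entries are continued to all pairs of indices. Then the formula for a matrix product needs
  no case distinction at the last row.\<close>

definition quant_entry :: "nat \<Rightarrow> real \<Rightarrow> real \<Rightarrow> real \<Rightarrow> real \<Rightarrow> nat \<Rightarrow> nat \<Rightarrow> complex" where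
  "quant_entry n u0 u v w a b =
    (if b = a then complex_of_real (u0 - u * (2 / real n) * (real n / 2 - real a))
     else if b = a + 1 then superdiag n v w a
     else if a = b + 1 then cnj (superdiag n v w b)
     else 0)"

lemma quant_mat_eq: "quant_mat n u0 u v w = Matrix.mat (n + 1) (n + 1) (\<lambda>(a, b). quant_entry n u0 u v w a b)"
  by (simp add: quant_mat_def quant_entry_def)

lemma quant_entry_Suc_Suc:
  "quant_entry n u0 u v w (Suc a) (Suc a) = quant_entry n u0 u v w a a + complex_of_real (2 / real n) * complex_of_real u"
  by (simp add: quant_entry_def algebra_simps add_divide_distrib)

lemma quant_entry_superdiag: "quant_entry n u0 u v w a (a + 1) = superdiag n v w a"
  by (simp add: quant_entry_def)

lemma quant_entry_subdiag: "quant_entry n u0 u v w (b + 1) b = cnj (superdiag n v w b)"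
  by (simp add: quant_entry_def)

lemma quant_entry_far: "b > a + 1 \<or> a > b + 1 \<Longrightarrow> quant_entry n u0 u v w a b = 0"
  by (auto simp: quant_entry_def)

text \<open>The row index \<open>a + 1\<close> runs out of range for \<open>a = n\<close>, but there its coefficient \<open>superdiag n v w n\<close>
  vanishes, the square root being \<open>0\<close>.\<close>

lemma quant_mat_mult_index:
  assumes "a \<le> n" "b \<le> n"
  shows "(quant_mat n u0 u v w * quant_mat n u0' u' v' w') $$ (a, b) =
      quant_entry n u0 u v w a a * quant_entry n u0' u' v' w' a b
    + superdiag n v w a * quant_entry n u0' u' v' w' (a + 1) b
    + (case a of 0 \<Rightarrow> 0 | Suc k \<Rightarrow> cnj (superdiag n v w k) * quant_entry n u0' u' v' w' k b)"
    (is "?lhs = _ * ?B a + ?s * _ + ?t")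
proof -
  have top: "superdiag n v w n = 0" by (simp add: superdiag_def)
  have "?lhs = (\<Sum>k\<in>{0..<n + 1}. quant_entry n u0 u v w a k * ?B k)"
    using assms by (simp add: quant_mat_eq scalar_prod_def del: sum.op_ivl_Suc)
  also have "\<dots> = (\<Sum>k\<in>{0..<n + 1}.
      (if k = a then quant_entry n u0 u v w a a * ?B a else 0)
      + (if k = a + 1 then ?s * ?B (a + 1) else 0)
      + (if k = a - 1 then ?t else 0))"
  proof (rule sum.cong[OF refl])
    fix k
    consider "k = a" | "k = a + 1" | "a = Suc k" | "k > a + 1" | "a > k + 1" by linarith
    then show "quant_entry n u0 u v w a k * ?B k =
        (if k = a then quant_entry n u0 u v w a a * ?B a else 0)
        + (if k = a + 1 then ?s * ?B (a + 1) else 0) + (if k = a - 1 then ?t else 0)"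
      by cases (simp_all add: quant_entry_superdiag[simplified] quant_entry_subdiag[simplified]
          quant_entry_far split: nat.split)
  qed
  also have "\<dots> = quant_entry n u0 u v w a a * ?B a + ?s * ?B (a + 1) + ?t"
    using assms top by (cases "a = n") (simp_all add: sum.distrib del: sum.op_ivl_Suc)
  finally show ?thesis .
qed


text \<open>The off-diagonal entry depends linearly on \<open>v - \<i>w\<close>, and multiplying \<open>v - \<i>w\<close> by \<open>\<i>\<close> is the
  quarter turn that the bracket with the first coordinate performs, up to the factor \<open>1 / c\<close>.\<close>

lemma superdiag_cross:
  "superdiag n ((w' * u - u' * w) / c) ((u' * v - v' * u) / c) l
    = - \<i> / complex_of_real c
      * (complex_of_real u' * superdiag n v w l - complex_of_real u * superdiag n v' w' l)"
proof -
  define r where "r = 1 / real n * sqrt ((real n - real l) * (1 + real l))"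
  have "superdiag n v w l = complex_of_real r * (complex_of_real v - \<i> * complex_of_real w)" for v w
    by (simp add: superdiag_def r_def)
  then show ?thesis
    by (simp only:) (simp add: algebra_simps add_divide_distrib diff_divide_distrib)
qed

text \<open>The matrices enter the diagonal of a commutator only through these products, in which the square
  roots disappear; the second component is \<open>Im ((v - \<i>w) (v' + \<i>w'))\<close>.\<close>

lemma superdiag_mult_cnj:
  assumes "l \<le> n"
  shows "superdiag n v w l * cnj (superdiag n v' w' l)
    = complex_of_real ((real n - real l) * (1 + real l) / (real n * real n))
      * Complex (v * v' + w * w') (v * w' - w * v')"
proof -
  define r where "r = 1 / real n * sqrt ((real n - real l) * (1 + real l))"
  have "superdiag n v w l = complex_of_real r * (complex_of_real v - \<i> * complex_of_real w)" for v w
    by (simp add: superdiag_def r_def)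
  then have "superdiag n v w l * cnj (superdiag n v' w' l)
      = complex_of_real (r * r) * Complex (v * v' + w * w') (v * w' - w * v')"
    by (simp only:) (simp add: complex_eq_iff algebra_simps)
  also have "r * r = (real n - real l) * (1 + real l) / (real n * real n)"
    using assms by (simp add: r_def)
  finally show ?thesis .
qed

text \<open>On the diagonal only the off-diagonal parts contribute, through the imaginary parts of
  \<open>superdiag_mult_cnj\<close>, and \<open>(n - a)(1 + a) - (n - a + 1) a = n - 2a\<close>. Next to the diagonal, the
  difference \<open>2u / n\<close> of consecutive diagonal entries multiplies the off-diagonal entries. Two steps
  from the diagonal the entries of both products agree, as complex numbers commute.\<close>

lemma quant_mat_commutator:
  assumes "n \<ge> 1"
  shows "quant_mat n 0 ((v' * w - w' * v) / real n) ((w' * u - u' * w) / real n) ((u' * v - v' * u) / real n)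
    = (- (\<i> / 2)) \<cdot>\<^sub>m commutator (quant_mat n u0 u v w) (quant_mat n u0' u' v' w')"
    (is "?L = _ \<cdot>\<^sub>m commutator ?A ?B")
proof (rule eq_matI)
  let ?s = "superdiag n v w" and ?s' = "superdiag n v' w'"
  let ?q = "quant_entry n 0 ((v' * w - w' * v) / real n) ((w' * u - u' * w) / real n) ((u' * v - v' * u) / real n)"
  have n0: "real n \<noteq> 0" using assms by simp
  fix a b
  assume "a < dim_row (- (\<i> / 2) \<cdot>\<^sub>m commutator ?A ?B)" "b < dim_col (- (\<i> / 2) \<cdot>\<^sub>m commutator ?A ?B)"
  then have ab: "a \<le> n" "b \<le> n" by (auto simp: commutator_def quant_mat_def)
  note prods = quant_mat_mult_index[OF ab]
  have "- (\<i> / 2) * ((?A * ?B) $$ (a, b) - (?B * ?A) $$ (a, b)) = ?q a b"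
  proof -
    consider "b = a" | "b = a + 1" | "a = b + 1" | "b = a + 2" | "a = b + 2" | "b > a + 2" | "a > b + 2"
      by linarith
    then show ?thesis
    proof cases
      case 1
      show ?thesis
      proof (cases a)
        case 0
        have "(?A * ?B) $$ (a, b) - (?B * ?A) $$ (a, b) = ?s 0 * cnj (?s' 0) - ?s' 0 * cnj (?s 0)"
          unfolding prods by (simp add: quant_entry_def 1 0)
        also have "\<dots> = 2 * \<i> * complex_of_real ((v * w' - w * v') / real n)"
          using n0 by (simp add: superdiag_mult_cnj complex_eq_iff) (simp add: field_simps)
        finally show ?thesis
          using n0 by (simp add: quant_entry_def 1 0 complex_eq_iff) (simp add: field_simps)
      next
        case (Suc k)
        have "(?A * ?B) $$ (a, b) - (?B * ?A) $$ (a, b) = (?s a * cnj (?s' a) - ?s' a * cnj (?s a))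
            - (?s k * cnj (?s' k) - ?s' k * cnj (?s k))"
          unfolding prods by (simp add: quant_entry_def 1 Suc)
        also have "\<dots> = 2 * \<i> * complex_of_real
            ((real n - 2 * real a) * (v * w' - w * v') / (real n * real n))"
          using n0 ab Suc by (simp add: superdiag_mult_cnj complex_eq_iff) (simp add: field_simps)
        finally show ?thesis
          using n0 by (simp add: quant_entry_def 1 complex_eq_iff) (simp add: field_simps)
      qed
    next
      case 2
      have "(?A * ?B) $$ (a, b) - (?B * ?A) $$ (a, b)
          = complex_of_real (2 / real n) * (complex_of_real u' * ?s a - complex_of_real u * ?s' a)"
        unfolding prods unfolding 2
        by (cases a) (simp_all add: quant_entry_Suc_Suc quant_entry_superdiag[simplified] quant_entry_far algebra_simps)
      also have "- (\<i> / 2) * \<dots> = ?q a b"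
        unfolding 2 quant_entry_superdiag superdiag_cross using n0 by (simp add: field_simps)
      finally show ?thesis .
    next
      case 3
      have "(?A * ?B) $$ (a, b) - (?B * ?A) $$ (a, b)
          = - complex_of_real (2 / real n) * (complex_of_real u' * cnj (?s b) - complex_of_real u * cnj (?s' b))"
        unfolding prods unfolding 3
        by (simp add: quant_entry_Suc_Suc quant_entry_subdiag[simplified] quant_entry_far algebra_simps)
      also have "- (\<i> / 2) * \<dots> = ?q a b"
        unfolding 3 quant_entry_subdiag superdiag_cross using n0 by (simp add: field_simps)
      finally show ?thesis .
    next
      case 4
      then show ?thesis
        unfolding prods by (cases a) (simp_all add: quant_entry_def superdiag_def mult_ac)
    next
      case 5
      then show ?thesis
        unfolding prods by (simp add: quant_entry_def superdiag_def mult_ac)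
    next
      case 6
      then show ?thesis
        unfolding prods by (cases a) (simp_all add: quant_entry_def)
    next
      case 7
      then show ?thesis
        unfolding prods by (cases a) (simp_all add: quant_entry_def)
    qed
  qed
  moreover have "(- (\<i> / 2) \<cdot>\<^sub>m commutator ?A ?B) $$ (a, b)
      = - (\<i> / 2) * ((?A * ?B) $$ (a, b) - (?B * ?A) $$ (a, b))"
    using ab by (simp add: commutator_def quant_mat_def)
  ultimately show "?L $$ (a, b) = (- (\<i> / 2) \<cdot>\<^sub>m commutator ?A ?B) $$ (a, b)"
    using ab by (simp add: quant_mat_eq)
qed (auto simp: commutator_def quant_mat_def)

theorem lemma9p9:
  fixes n :: nat
  assumes "n \<ge> 1"
  shows "quantQ n \<in> kahler_functions_S2 n \<rightarrow> Herm (n + 1) \<and>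
    (\<forall>f \<in> kahler_functions_S2 n. \<forall>g \<in> kahler_functions_S2 n.
       quantQ n (poisson_S2 n f g)
         = (- (\<i> / 2)) \<cdot>\<^sub>m commutator (quantQ n f) (quantQ n g))"
proof (intro conjI ballI Pi_I)
  fix f assume "f \<in> kahler_functions_S2 n"
  then obtain c a where "\<And>p. p \<in> S2 \<Longrightarrow> f p = c + a \<bullet> p"
    using kahler_function_affine[OF assms] by metis
  then show "quantQ n f \<in> Herm (n + 1)"
    using quantQ_affine quant_mat_Herm by metis
next
  fix f g assume "f \<in> kahler_functions_S2 n" "g \<in> kahler_functions_S2 n"
  then obtain c a d b where f: "\<And>p. p \<in> S2 \<Longrightarrow> f p = c + a \<bullet> p"
    and g: "\<And>p. p \<in> S2 \<Longrightarrow> g p = d + b \<bullet> p"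
    using kahler_function_affine[OF assms] by metis
  have "poisson_S2 n f g p = 0 + ((1 / real n) *\<^sub>R cross3 b a) \<bullet> p" if "p \<in> S2" for p
    using poisson_S2_affine[OF assms that f g] by simp
  from quantQ_affine[OF this, of n] have "quantQ n (poisson_S2 n f g) = quant_mat n 0 ((b $ 2 * a $ 3 - b $ 3 * a $ 2) / real n)
      ((b $ 3 * a $ 1 - b $ 1 * a $ 3) / real n) ((b $ 1 * a $ 2 - b $ 2 * a $ 1) / real n)"
    by (simp add: cross_components mult.commute)
  also have "\<dots> = (- (\<i> / 2)) \<cdot>\<^sub>m commutator
      (quant_mat n c (a $ 1) (a $ 2) (a $ 3)) (quant_mat n d (b $ 1) (b $ 2) (b $ 3))"
    by (rule quant_mat_commutator[OF assms])
  finally show "quantQ n (poisson_S2 n f g)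
      = (- (\<i> / 2)) \<cdot>\<^sub>m commutator (quantQ n f) (quantQ n g)"
    by (simp only: quantQ_affine[OF f] quantQ_affine[OF g])
qed

end
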